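(* Let $f:\mathbb{C}[x,y]\to\mathbb{C}[x,y]$ be a $\mathbb{C}$-algebra endomorphism, put $p:=f(x)$ and $q:=f(y)$, and assume $\operatorname{Jac}(p,q)\in\mathbb{C}^*$. If there exist an integer $n\geq 1$, $a\in\mathbb{C}(p,q)^*$ and $b\in\mathbb{C}(p,q)$ such that $(ax+b)^n\in\mathbb{C}(p,q)$, then $f$ is invertible.
   Context: $\mathbb{C}[x,y]$ is the polynomial ring in two variables over $\mathbb{C}$ and $\mathbb{C}(x,y)$ its field of fractions. $\operatorname{Jac}(p,q)=\frac{\partial p}{\partial x}\frac{\partial q}{\partial y}-\frac{\partial p}{\partial y}\frac{\partial q}{\partial x}$ is the Jacobian determinant. $\mathbb{C}(p,q)$ is the subfield of $\mathbb{C}(x,y)$ generated over $\mathbb{C}$ by $p$ and $q$, and $\mathbb{C}(p,q)^*$ is its set of nonzero elements; likewise $\mathbb{C}^*=\mathbb{C}\setminus\{0\}$. "$f$ is invertible" means that $f$ is a $\mathbb{C}$-algebra automorphism of $\mathbb{C}[x,y]$. *)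

theory Defs
  imports "HOL-Algebra.Generated_Fields" "HOL-Algebra.Algebraic_Closure_Type"
    "HOL-Computational_Algebra.Computational_Algebra"
begin

text \<open>
  The ring of polynomials in \<open>x\<close> and \<open>y\<close> is represented as polynomials in \<open>y\<close> whose coefficients
  are polynomials in \<open>x\<close>: the inner variable is \<open>x\<close> and the outer one is \<open>y\<close>.
\<close>

type_synonym cpoly2 = "complex poly poly"
type_synonym crat2 = "complex poly poly fract"

definition Const :: "complex \<Rightarrow> cpoly2" where
  "Const c = [:[:c:]:]"

definition Xpoly :: cpoly2 where
  "Xpoly = [:[:0, 1:]:]"

definition Ypoly :: cpoly2 where
  "Ypoly = [:0, 1:]"

definition pderiv_x :: "cpoly2 \<Rightarrow> cpoly2" where
  "pderiv_x u = map_poly pderiv u"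

definition pderiv_y :: "cpoly2 \<Rightarrow> cpoly2" where
  "pderiv_y u = pderiv u"

definition Jac :: "cpoly2 \<Rightarrow> cpoly2 \<Rightarrow> cpoly2" where
  "Jac p q = pderiv_x p * pderiv_y q - pderiv_y p * pderiv_x q"

text \<open>
  The structure map of the algebra is \<^const>\<open>Const\<close>, so a ring homomorphism is a homomorphism
  of algebras over the complex numbers iff it fixes all constants.
\<close>

definition alg_endomorphism :: "(cpoly2 \<Rightarrow> cpoly2) \<Rightarrow> bool" where
  "alg_endomorphism f \<longleftrightarrow>
     f \<in> ring_hom ring_of_type_algebra ring_of_type_algebra \<and> (\<forall>c. f (Const c) = Const c)"

definition alg_automorphism :: "(cpoly2 \<Rightarrow> cpoly2) \<Rightarrow> bool" where
  "alg_automorphism f \<longleftrightarrow> alg_endomorphism f \<and> bij f"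

definition gen_subfield :: "cpoly2 \<Rightarrow> cpoly2 \<Rightarrow> crat2 set" where
  "gen_subfield p q =
     generate_field ring_of_type_algebra (range (\<lambda>c. to_fract (Const c)) \<union> {to_fract p, to_fract q})"

end

theory Submission
  imports Defs
begin

text \<open>
  Write \<open>B\<close> for the polynomial ring, \<open>A\<close> for the image of \<open>f\<close> and \<open>K\<close> for the fraction field
  of \<open>A\<close> inside the fraction field of \<open>B\<close>. Geometrically, a map of the plane whose Jacobian
  determinant is a nonzero constant is etale, and a cyclic extension of \<open>K\<close> inside the function
  field of \<open>B\<close> would have to ramify over some curve of the target plane, because that plane is
  simply connected. The proof is an algebraic form of this remark.

  The chain rule makes \<open>f\<close> injective, so \<open>A\<close> is again a polynomial ring and factors uniquely. Take
  a prime \<open>\<pi>\<close> of \<open>B\<close> and a prime factor \<open>\<rho>\<close> of \<open>f \<pi>\<close> (there is one, since \<open>f \<pi>\<close> cannot be a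
  constant). If \<open>\<rho>\<close> divided both \<open>f \<pi>\<close> and \<open>f H\<close> with \<open>\<pi>\<close> not dividing \<open>H\<close>, then elimination would make
  \<open>p\<close> and \<open>q\<close> constant modulo \<open>\<rho>\<close>, and \<open>\<rho>\<close> would divide the Jacobian determinant. If \<open>\<rho>\<close> divided
  \<open>f \<pi>\<close> twice, then it would divide the images of both partial derivatives of \<open>\<pi>\<close>, so \<open>\<pi>\<close> would
  divide its own partial derivatives. Hence \<open>\<rho>\<close> occurs in \<open>f G\<close> exactly as often as \<open>\<pi>\<close> occurs in \<open>G\<close>
  (\<open>multiplicity_f\<close>). Comparing multiplicities gives \<open>A = B \<inter> K\<close>, and shows that an element of \<open>B\<close> whose
  \<open>n\<close>-th power lies in \<open>A\<close> lies in \<open>A\<close> itself; clearing denominators, \<open>K\<close> is closed under roots too.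

  So if \<open>(a x + b)\<^sup>n\<close> is in \<open>K\<close>, then so are \<open>a x + b\<close> and \<open>x\<close>, and \<open>x\<close> lies in \<open>B \<inter> K = A\<close>. Then \<open>\<partial>/\<partial>y\<close>,
  which is the derivation \<open>Jac x\<close>, maps \<open>A\<close> to \<open>A\<close>. Differentiating lowers the degree in \<open>y\<close>, so \<open>A\<close>
  contains some \<open>b(x) y + a(x)\<close> with nonzero \<open>b\<close>; thus \<open>y\<close> is in \<open>B \<inter> K = A\<close>, and \<open>f\<close> is surjective.
\<close>

section \<open>Polynomials in two variables\<close>

lemma Const_simps:
  "Const 0 = 0" "Const 1 = 1" "Const (- c) = - Const c" "Const (c + d) = Const c + Const d"
  "Const (c * d) = Const c * Const d" "Const c = 0 \<longleftrightarrow> c = 0"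
  by (simp_all add: Const_def one_pCons)

lemma is_unit_iff_Const: "(u :: cpoly2) dvd 1 \<longleftrightarrow> (\<exists>c. c \<noteq> 0 \<and> u = Const c)"
  by (auto simp: is_unit_poly_iff Const_def dvd_field_iff)

lemma not_prime_elem_Const: "\<not> prime_elem (Const c)"
  using is_unit_iff_Const by (cases "c = 0") (auto simp: prime_elem_def Const_simps)

lemma const_poly_induct [case_names Const X add mult]:
  assumes "\<And>c. P (Const c)" "P Xpoly"
    and "\<And>u v. P u \<Longrightarrow> P v \<Longrightarrow> P (u + v)" "\<And>u v. P u \<Longrightarrow> P v \<Longrightarrow> P (u * v)"
  shows "P [:g:]"
proof (induction g)
  case 0
  show ?case using assms(1)[of 0] by (simp add: Const_def)
next
  case (pCons c g)
  have "P (Const c + Xpoly * [:g:])"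
    using pCons.IH assms by blast
  then show ?case by (simp add: Const_def Xpoly_def)
qed

lemma cpoly2_induct [case_names Const X Y add mult]:
  assumes "\<And>c. P (Const c)" "P Xpoly" "P Ypoly"
    and "\<And>u v. P u \<Longrightarrow> P v \<Longrightarrow> P (u + v)" "\<And>u v. P u \<Longrightarrow> P v \<Longrightarrow> P (u * v)"
  shows "P u"
proof (induction u)
  case 0
  show ?case using assms(1)[of 0] by (simp add: Const_def)
next
  case (pCons g u)
  have "P [:g:]"
    by (rule const_poly_induct) (use assms in blast)+
  then have "P ([:g:] + Ypoly * u)"
    using pCons.IH assms by blast
  then show ?case by (simp add: Ypoly_def)
qed

lemma pderiv_x_add: "pderiv_x (u + v) = pderiv_x u + pderiv_x v"
  by (rule poly_eqI) (simp add: pderiv_x_def coeff_map_poly pderiv_add)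

lemma pderiv_x_mult: "pderiv_x (u * v) = u * pderiv_x v + v * pderiv_x u"
proof (rule poly_eqI)
  fix n
  have pderiv_sum: "pderiv (\<Sum>i\<in>A. g i) = (\<Sum>i\<in>A. pderiv (g i))"
    for g :: "nat \<Rightarrow> complex poly" and A
    by (induction A rule: infinite_finite_induct) (simp_all add: pderiv_add)
  have "Polynomial.coeff (pderiv_x (u * v)) n = 
      Polynomial.coeff (u * pderiv_x v) n + Polynomial.coeff (pderiv_x u * v) n"
    by (simp add: pderiv_x_def coeff_map_poly coeff_mult pderiv_sum pderiv_mult sum.distrib
        mult.commute[of "Polynomial.coeff v k" for k])
  then show "Polynomial.coeff (pderiv_x (u * v)) n = Polynomial.coeff (u * pderiv_x v + v * pderiv_x u) n"
    by (simp add: mult.commute)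
qed

lemma pderiv_x_simps:
  "pderiv_x [:g:] = [:pderiv g:]" "pderiv_x (Const c) = 0" "pderiv_x Xpoly = 1" "pderiv_x Ypoly = 0"
  by (simp_all add: pderiv_x_def Const_def Xpoly_def Ypoly_def map_poly_pCons pderiv_pCons one_pCons)

lemma pderiv_y_simps:
  "pderiv_y [:g:] = 0" "pderiv_y (Const c) = 0" "pderiv_y Xpoly = 0" "pderiv_y Ypoly = 1"
  by (simp_all add: pderiv_y_def Const_def Xpoly_def Ypoly_def pderiv_pCons one_pCons)

lemma pderiv_y_add: "pderiv_y (u + v) = pderiv_y u + pderiv_y v"
  by (simp add: pderiv_y_def pderiv_add)

lemma pderiv_y_mult: "pderiv_y (u * v) = u * pderiv_y v + v * pderiv_y u"
  by (simp add: pderiv_y_def pderiv_mult)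

lemma Jac_add_Const: "Jac (u + Const c) (v + Const d) = Jac u v"
  by (simp add: Jac_def pderiv_x_add pderiv_y_add pderiv_x_simps pderiv_y_simps)

text \<open>
  If two functions vanish on a curve, then their gradients are parallel there.
\<close>

lemma dvd_Jac_common_factor: "r dvd Jac (r * u) (r * v)"
proof
  show "Jac (r * u) (r * v) = r * (pderiv_x r * u * pderiv_y v + pderiv_x u * pderiv_y r * v
      + r * pderiv_x u * pderiv_y v - pderiv_y r * u * pderiv_x v - pderiv_y u * pderiv_x r * v
      - r * pderiv_y u * pderiv_x v)"
    by (simp add: Jac_def pderiv_x_mult pderiv_y_mult algebra_simps)
qed

lemma dvd_Jac_square_left: "r dvd Jac (r * r * u) v"
proof
  show "Jac (r * r * u) v = r * ((2 * pderiv_x r * u + r * pderiv_x u) * pderiv_y v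
      - (2 * pderiv_y r * u + r * pderiv_y u) * pderiv_x v)"
    by (simp add: Jac_def pderiv_x_mult pderiv_y_mult algebra_simps)
qed

lemma dvd_Jac_square_right: "r dvd Jac u (r * r * v)"
proof -
  have "Jac u (r * r * v) = - Jac (r * r * v) u"
    by (simp add: Jac_def algebra_simps)
  then show ?thesis using dvd_Jac_square_left by simp
qed

text \<open>
  Differentiation lowers the degree, so a divisor of its own derivative has derivative zero; a
  polynomial with both partial derivatives zero is a constant.
\<close>

lemma prime_not_dvd_both_derivatives:
  assumes "prime_elem \<pi>"
  shows "\<not> (\<pi> dvd pderiv_x \<pi> \<and> \<pi> dvd pderiv_y \<pi>)"
proof
  assume *: "\<pi> dvd pderiv_x \<pi> \<and> \<pi> dvd pderiv_y \<pi>"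
  then have "Polynomial.degree \<pi> = 0" by (simp add: pderiv_y_def)
  then obtain g where g: "\<pi> = [:g:]" by (rule degree_eq_zeroE)
  with * have "Polynomial.degree g = 0" by (simp add: pderiv_x_simps)
  then obtain c where "g = [:c:]" by (rule degree_eq_zeroE)
  with g assms show False using not_prime_elem_Const[of c] by (simp add: Const_def)
qed

text \<open>
  The inclusion of the polynomials in \<open>y\<close> alone.
\<close>

definition lift_y :: "complex poly \<Rightarrow> cpoly2" where
  "lift_y h = map_poly (\<lambda>c. [:c:]) h"

lemma lift_y_mult: "lift_y (g * h) = lift_y g * lift_y h"
proof -
  have smult: "lift_y (smult c u) = smult [:c:] (lift_y u)" for c u
    by (rule poly_eqI) (simp add: lift_y_def coeff_map_poly)
  have add: "lift_y (u + v) = lift_y u + lift_y v" for u v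
    by (rule poly_eqI) (simp add: lift_y_def coeff_map_poly)
  have pCons: "lift_y (pCons c u) = pCons [:c:] (lift_y u)" for c u
    by (simp add: lift_y_def map_poly_pCons)
  show ?thesis
    by (induction g) (simp_all add: smult add pCons, simp add: lift_y_def)
qed

lemma lift_y_simps: "lift_y [:c:] = Const c" "lift_y [:- c, 1:] = Ypoly - Const c"
  by (simp_all add: lift_y_def map_poly_pCons Const_def Ypoly_def one_pCons)

definition specialise_x :: "complex \<Rightarrow> cpoly2 \<Rightarrow> complex poly" where
  "specialise_x \<alpha> G = map_poly (\<lambda>g. poly g \<alpha>) G"

text \<open>
  Modulo \<open>x - \<alpha>\<close>, every polynomial agrees with a polynomial in \<open>y\<close> alone.
\<close>

lemma dvd_diff_specialise_x: "(Xpoly - Const \<alpha>) dvd G - lift_y (specialise_x \<alpha> G)"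
proof -
  have X: "Xpoly - Const \<alpha> = [:[:- \<alpha>, 1:]:]"
    by (simp add: Xpoly_def Const_def)
  have "[:- \<alpha>, 1:] dvd g - [:poly g \<alpha>:]" for g
    by (simp add: poly_eq_0_iff_dvd[symmetric])
  then show ?thesis
    unfolding X const_poly_dvd_iff
    by (simp add: lift_y_def specialise_x_def coeff_map_poly)
qed

text \<open>
  Every nonzero complex polynomial splits into linear factors, and a prime dividing the image of
  the product divides the image of one of them. The two uses are the polynomials in \<open>x\<close> alone and
  those in \<open>y\<close> alone, so \<open>\<phi>\<close> is left abstract.
\<close>

lemma prime_dvd_linear_factor:
  fixes \<phi> :: "complex poly \<Rightarrow> 'a :: comm_semiring_1"
  assumes mult: "\<And>g h. \<phi> (g * h) = \<phi> g * \<phi> h"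
    and unit: "\<And>c. c \<noteq> 0 \<Longrightarrow> \<phi> [:c:] dvd 1"
    and \<rho>: "prime_elem \<rho>"
  shows "\<rho> dvd \<phi> g \<Longrightarrow> g \<noteq> 0 \<Longrightarrow> \<exists>\<alpha>. \<rho> dvd \<phi> [:- \<alpha>, 1:]"
proof (induction g rule: measure_induct_rule[of Polynomial.degree])
  case (less g)
  show ?case
  proof (cases "Polynomial.degree g = 0")
    case True
    then obtain c where "g = [:c:]" by (rule degree_eq_zeroE)
    with less.prems unit[of c] have "\<rho> dvd 1" by (auto intro: dvd_trans)
    with \<rho> show ?thesis by (simp add: prime_elem_def)
  next
    case False
    then obtain \<alpha> where "poly g \<alpha> = 0"
      using fundamental_theorem_of_algebra[of g] constant_degree[of g] by auto
    then obtain h where h: "g = [:- \<alpha>, 1:] * h"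
      by (auto simp: poly_eq_0_iff_dvd elim: dvdE)
    with less.prems have "h \<noteq> 0" by auto
    then have "Polynomial.degree h < Polynomial.degree g"
      using h by (simp add: degree_mult_eq del: mult_pCons_left)
    moreover have "\<rho> dvd \<phi> [:- \<alpha>, 1:] \<or> \<rho> dvd \<phi> h"
      using less.prems(1) \<rho> unfolding h mult by (simp add: prime_elem_dvd_mult_iff)
    ultimately show ?thesis using less.IH \<open>h \<noteq> 0\<close> by blast
  qed
qed

text \<open>
  Elimination of \<open>y\<close>. Two polynomials without a common factor generate an ideal that contains a
  nonzero polynomial in \<open>x\<close> alone: an element of least degree in \<open>y\<close> divides, up to a factor in \<open>x\<close>,
  every element of the ideal by pseudo-division, so a prime factor of positive degree in \<open>y\<close> would
  be a common factor of the generators.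
\<close>

lemma bezout_prime_elem:
  fixes \<pi> H :: cpoly2
  assumes "prime_elem \<pi>" "\<not> \<pi> dvd H"
  shows "\<exists>a b r. r \<noteq> 0 \<and> a * \<pi> + b * H = [:r:]"
proof -
  define I where "I = {a * \<pi> + b * H | a b. True}"
  have I: "u - v * w \<in> I" if uw: "u \<in> I" "w \<in> I" for u v w
  proof -
    obtain a b a' b' where "u = a * \<pi> + b * H" "w = a' * \<pi> + b' * H"
      using uw unfolding I_def by blast
    then have "u - v * w = (a - v * a') * \<pi> + (b - v * b') * H" by (simp add: algebra_simps)
    then show ?thesis unfolding I_def by blast
  qed
  have smult: "smult c u \<in> I" if "u \<in> I" for c u
  proof -
    have "smult c u = u - (1 - [:c:]) * u" by (simp add: algebra_simps)
    then show ?thesis using I that by metis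
  qed
  have "\<pi> = 1 * \<pi> + 0 * H" "H = 0 * \<pi> + 1 * H" by simp_all
  then have gens: "\<pi> \<in> I" "H \<in> I" unfolding I_def by blast+
  have "\<pi> \<noteq> 0" using assms by auto
  then obtain m where m: "m \<in> I" "m \<noteq> 0"
    and min: "\<And>v. v \<in> I \<Longrightarrow> v \<noteq> 0 \<Longrightarrow> Polynomial.degree m \<le> Polynomial.degree v"
    using gens ex_has_least_nat[of "\<lambda>u. u \<in> I \<and> u \<noteq> 0" \<pi> Polynomial.degree] by blast
  \<comment> \<open>The pseudo-remainder of \<open>u\<close> by \<open>m\<close> lies in the ideal and has smaller degree than \<open>m\<close>, so it is zero.\<close>
  have m_dvd: "\<exists>c. c \<noteq> 0 \<and> m dvd smult c u" if "u \<in> I" for u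
  proof -
    obtain c v where c: "c \<noteq> 0" "smult c u = m * v + pseudo_mod u m"
      using pseudo_mod(1)[OF m(2), of u] by blast
    then have "pseudo_mod u m = smult c u - v * m" by (simp add: mult.commute)
    then have "pseudo_mod u m \<in> I" using I smult m(1) that by simp
    then have "pseudo_mod u m = 0" using min degree_pseudo_mod_less[OF m(2)] by fastforce
    with c show ?thesis by auto
  qed
  have deg0: "Polynomial.degree \<sigma> = 0" if "Factorial_Ring.prime \<sigma>" "\<sigma> dvd m" for \<sigma>
  proof (rule ccontr)
    assume deg: "Polynomial.degree \<sigma> \<noteq> 0"
    have \<sigma>_dvd: "\<sigma> dvd u" if "u \<in> I" for u
    proof -
      obtain c where c: "c \<noteq> 0" "m dvd [:c:] * u" using m_dvd[OF \<open>u \<in> I\<close>] by auto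
      then have "\<sigma> dvd [:c:] * u" using \<open>\<sigma> dvd m\<close> dvd_trans by blast
      moreover have "\<not> \<sigma> dvd [:c:]"
        using deg c(1) dvd_imp_degree_le[of \<sigma> "[:c:]"] by auto
      ultimately show ?thesis
        using \<open>Factorial_Ring.prime \<sigma>\<close> by (meson prime_dvd_mult_iff)
    qed
    obtain u where "\<pi> = \<sigma> * u" using \<sigma>_dvd[OF gens(1)] by (rule dvdE)
    moreover have "\<not> \<sigma> dvd 1" using that(1) by auto
    ultimately have "u dvd 1"
      using prime_elem_imp_irreducible[OF assms(1)] by (auto simp: Factorial_Ring.irreducible_def)
    then have "\<pi> dvd \<sigma>" using \<open>\<pi> = \<sigma> * u\<close> by (simp add: mult_unit_dvd_iff)
    with \<sigma>_dvd[OF gens(2)] assms(2) show False using dvd_trans by blast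
  qed
  have "v dvd m \<Longrightarrow> Polynomial.degree v = 0" for v
  proof (induction v rule: prime_divisors_induct)
    case zero
    then show ?case by simp
  next
    case (unit v)
    then show ?case by (auto simp: is_unit_poly_iff)
  next
    case (factor \<sigma> v)
    then have "Polynomial.degree \<sigma> = 0" "Polynomial.degree v = 0"
      using deg0 dvd_mult_left dvd_mult_right by blast+
    then show ?case using degree_mult_le[of \<sigma> v] by simp
  qed
  then obtain r where "m = [:r:]" by (meson degree_eq_zeroE dvd_refl)
  moreover from m(1) obtain a b where "m = a * \<pi> + b * H" by (auto simp: I_def)
  ultimately show ?thesis using m(2) by (metis pCons_0_0)
qed

lemma to_fract_power: "to_fract (u ^ n) = to_fract u ^ n"
  by (induction n) simp_all

section \<open>Keller maps\<close>

locale keller_map =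
  fixes f :: "cpoly2 \<Rightarrow> cpoly2"
  assumes endo: "alg_endomorphism f"
    and jac: "\<exists>c. c \<noteq> 0 \<and> Jac (f Xpoly) (f Ypoly) = Const c"
begin

lemma f_add: "f (u + v) = f u + f v" and f_mult: "f (u * v) = f u * f v"
  and f_Const: "f (Const c) = Const c"
  using endo by (auto simp: alg_endomorphism_def ring_hom_def ring_of_type_algebra_def)

lemma f_0: "f 0 = 0" and f_1: "f 1 = 1"
  using f_Const[of 0] f_Const[of 1] by (simp_all add: Const_simps)

lemma f_uminus: "f (- u) = - f u"
  using f_add[of u "- u"] by (simp add: f_0 add_eq_0_iff2 minus_equation_iff)

lemma f_diff: "f (u - v) = f u - f v"
  using f_add[of u "- v"] by (simp add: f_uminus)

lemma f_power: "f (u ^ n) = f u ^ n"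
  by (induction n) (simp_all add: f_mult f_1)

lemmas f_simps = f_add f_mult f_Const f_0 f_1 f_uminus f_diff f_power

lemma f_dvd: "u dvd v \<Longrightarrow> f u dvd f v"
  by (auto simp: f_mult elim!: dvdE)

lemma is_unit_jac: "Jac (f Xpoly) (f Ypoly) dvd 1"
  using jac is_unit_iff_Const by blast

lemma chain_rule:
  assumes "\<And>u v. D (u + v) = D u + D v" "\<And>u v. D (u * v) = u * D v + v * D u"
    and "\<And>c. D (Const c) = 0"
  shows "D (f G) = f (pderiv_x G) * D (f Xpoly) + f (pderiv_y G) * D (f Ypoly)"
  by (induction G rule: cpoly2_induct)
     (simp_all add: assms f_simps pderiv_x_simps pderiv_y_simps pderiv_x_add pderiv_y_add
       pderiv_x_mult pderiv_y_mult algebra_simps)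

text \<open>
  The Jacobian matrix of a composition is a product, and determinants are multiplicative.
\<close>

lemma Jac_f: "Jac (f G) (f H) = f (Jac G H) * Jac (f Xpoly) (f Ypoly)"
proof -
  note x = chain_rule[of pderiv_x, OF pderiv_x_add pderiv_x_mult pderiv_x_simps(2)]
  note y = chain_rule[of pderiv_y, OF pderiv_y_add pderiv_y_mult pderiv_y_simps(2)]
  show ?thesis
    unfolding Jac_def x[of G] x[of H] y[of G] y[of H]
    by (simp add: f_simps algebra_simps)
qed

lemma Jac_f_Ypoly: "Jac (f G) (f Ypoly) = f (pderiv_x G) * Jac (f Xpoly) (f Ypoly)"
  unfolding Jac_f[of G] by (simp add: Jac_def[of G] pderiv_x_simps pderiv_y_simps)

lemma Jac_f_Xpoly: "Jac (f Xpoly) (f G) = f (pderiv_y G) * Jac (f Xpoly) (f Ypoly)"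
  unfolding Jac_f[of Xpoly G] by (simp add: Jac_def[of _ G] pderiv_x_simps pderiv_y_simps)

lemma f_derivatives_eq_0:
  assumes "f G = 0"
  shows "f (pderiv_x G) = 0" "f (pderiv_y G) = 0"
proof -
  have "Jac 0 u = 0" "Jac u 0 = 0" for u
    by (simp_all add: Jac_def pderiv_x_def pderiv_y_def)
  moreover have "Jac (f Xpoly) (f Ypoly) \<noteq> 0"
    using is_unit_jac by auto
  ultimately show "f (pderiv_x G) = 0" "f (pderiv_y G) = 0"
    using Jac_f_Ypoly[of G] Jac_f_Xpoly[of G] assms by simp_all
qed

text \<open>
  If \<open>f G = 0\<close> then Cramer's rule gives \<open>f G' = 0\<close> for both partial derivatives \<open>G'\<close> of \<open>G\<close>. They have
  smaller degree, so by induction they vanish and \<open>G\<close> is a constant, which \<open>f\<close> fixes. The induction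
  runs over the degree in \<open>x\<close> for polynomials in \<open>x\<close> alone, and then over the degree in \<open>y\<close>.
\<close>

lemma f_eq_0_iff: "f G = 0 \<longleftrightarrow> G = 0"
proof
  have x: "f [:g:] = 0 \<Longrightarrow> g = 0" for g
  proof (induction g rule: measure_induct_rule[of Polynomial.degree])
    case (less g)
    show ?case
    proof (cases "Polynomial.degree g = 0")
      case True
      then obtain c where "g = [:c:]" by (rule degree_eq_zeroE)
      with less.prems f_Const[of c] show ?thesis by (simp add: Const_def)
    next
      case False
      moreover have "f [:pderiv g:] = 0"
        using f_derivatives_eq_0(1)[OF less.prems] by (simp add: pderiv_x_simps)
      ultimately have "pderiv g = 0" using less.IH[of "pderiv g"] by (simp add: degree_pderiv)
      with False show ?thesis by (simp add: pderiv_eq_0_iff)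
    qed
  qed
  show "f G = 0 \<Longrightarrow> G = 0"
  proof (induction G rule: measure_induct_rule[of Polynomial.degree])
    case (less G)
    show ?case
    proof (cases "Polynomial.degree G = 0")
      case True
      then obtain g where "G = [:g:]" by (rule degree_eq_zeroE)
      with less.prems x show ?thesis by simp
    next
      case False
      then have "pderiv G = 0"
        using less.IH[of "pderiv G"] f_derivatives_eq_0(2)[OF less.prems]
        by (simp add: degree_pderiv pderiv_y_def)
      with False show ?thesis by (simp add: pderiv_eq_0_iff)
    qed
  qed
qed (simp add: f_0)

lemma f_eq_iff: "f G = f H \<longleftrightarrow> G = H"
  using f_eq_0_iff[of "G - H"] by (simp add: f_diff)

lemma is_unit_f_iff: "f G dvd 1 \<longleftrightarrow> G dvd 1"
proof
  assume "f G dvd 1"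
  then obtain c where "c \<noteq> 0" "f G = Const c" using is_unit_iff_Const by blast
  then have "G = Const c" using f_eq_iff f_Const by metis
  with \<open>c \<noteq> 0\<close> show "G dvd 1" using is_unit_iff_Const by blast
qed (metis f_dvd f_1)

lemma prime_factor_of_f:
  assumes "prime_elem \<pi>"
  obtains \<rho> where "prime_elem \<rho>" "\<rho> dvd f \<pi>"
proof -
  have "f \<pi> \<noteq> 0" "\<not> f \<pi> dvd 1"
    using assms f_eq_0_iff is_unit_f_iff by (auto simp: prime_elem_def)
  then obtain \<rho> where "\<rho> dvd f \<pi>" "Factorial_Ring.prime \<rho>"
    using prime_divisor_exists by blast
  with that show ?thesis by blast
qed

section \<open>Prime factors under a Keller map\<close>

text \<open>
  A Keller map contracts no curve to a point: its Jacobian determinant would vanish on the curve.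
\<close>

lemma prime_not_dvd_both_coordinates:
  assumes "prime_elem \<rho>"
  shows "\<not> (\<rho> dvd f (Xpoly - Const \<alpha>) \<and> \<rho> dvd f (Ypoly - Const \<beta>))"
proof
  assume "\<rho> dvd f (Xpoly - Const \<alpha>) \<and> \<rho> dvd f (Ypoly - Const \<beta>)"
  then obtain u v where "f Xpoly - Const \<alpha> = \<rho> * u" "f Ypoly - Const \<beta> = \<rho> * v"
    by (auto simp: f_simps elim!: dvdE)
  then have "f Xpoly = \<rho> * u + Const \<alpha>" "f Ypoly = \<rho> * v + Const \<beta>"
    by (simp_all add: algebra_simps)
  then have "\<rho> dvd Jac (f Xpoly) (f Ypoly)"
    using dvd_Jac_common_factor by (simp add: Jac_add_Const)
  with is_unit_jac have "\<rho> dvd 1" by (rule dvd_trans[rotated])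
  with assms show False by (simp add: prime_elem_def)
qed

text \<open>
  If \<open>\<pi>\<close> did not divide \<open>H\<close>, then the curves \<open>\<pi> = 0\<close> and \<open>H = 0\<close> would meet in finitely many points,
  but a Keller map sends no curve into a
  finite set. Elimination yields \<open>\<alpha>\<close> with \<open>f (x - \<alpha>)\<close> divisible by \<open>\<rho>\<close>. Substituting \<open>x = \<alpha>\<close> leaves
  polynomials in \<open>y\<close>; a nonzero one would give \<open>\<beta>\<close> with \<open>f (y - \<beta>)\<close> divisible by \<open>\<rho>\<close>, which is
  impossible. So both substitutions give zero, \<open>\<pi>\<close> is associated to \<open>x - \<alpha>\<close>, and it divides \<open>H\<close>.
\<close>

lemma prime_lying_over_unique:
  assumes \<pi>: "prime_elem \<pi>" and \<rho>: "prime_elem \<rho>" and "\<rho> dvd f \<pi>" "\<rho> dvd f H"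
  shows "\<pi> dvd H"
proof -
  \<comment> \<open>\<open>\<rho>\<close> cannot divide the image of a nonzero polynomial in \<open>y\<close> as well.\<close>
  have no_y: False if X: "\<rho> dvd f (Xpoly - Const \<alpha>)" and "\<rho> dvd f (lift_y h)" "h \<noteq> 0" for \<alpha> h
  proof -
    have "\<exists>\<beta>. \<rho> dvd f (lift_y [:- \<beta>, 1:])"
      by (rule prime_dvd_linear_factor[of "\<lambda>h. f (lift_y h)" \<rho> h])
         (use that \<rho> in \<open>auto simp: f_simps lift_y_mult lift_y_simps is_unit_iff_Const\<close>)
    with X prime_not_dvd_both_coordinates[OF \<rho>] show False by (auto simp: lift_y_simps)
  qed
  have spec: "\<rho> dvd f (lift_y (specialise_x \<alpha> G))"
    if "\<rho> dvd f (Xpoly - Const \<alpha>)" "\<rho> dvd f G" for \<alpha> G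
  proof -
    have "\<rho> dvd f G - f (lift_y (specialise_x \<alpha> G))"
      using f_dvd[OF dvd_diff_specialise_x[of \<alpha> G]] that(1) by (metis dvd_trans f_diff)
    then have "\<rho> dvd f G - (f G - f (lift_y (specialise_x \<alpha> G)))"
      using that(2) by (rule dvd_diff[rotated])
    then show ?thesis by simp
  qed
  \<comment> \<open>Here \<open>x - \<alpha>\<close> divides both \<open>\<pi>\<close> and \<open>H\<close>, and \<open>\<pi>\<close> is irreducible.\<close>
  have common_x: ?thesis if X: "\<rho> dvd f (Xpoly - Const \<alpha>)" for \<alpha>
  proof -
    have zero: "specialise_x \<alpha> G = 0" if "\<rho> dvd f G" for G
      using no_y[OF X spec[OF X that]] by blast
    have dvd: "(Xpoly - Const \<alpha>) dvd G" if "\<rho> dvd f G" for G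
      using dvd_diff_specialise_x[of \<alpha> G] zero[OF that] by (simp add: lift_y_def)
    obtain u where u: "\<pi> = (Xpoly - Const \<alpha>) * u"
      using dvd[OF \<open>\<rho> dvd f \<pi>\<close>] by (rule dvdE)
    moreover have "\<not> (Xpoly - Const \<alpha>) dvd 1"
    proof
      assume "(Xpoly - Const \<alpha>) dvd 1"
      then have "f (Xpoly - Const \<alpha>) dvd 1" by (simp add: is_unit_f_iff)
      with X \<rho> show False by (meson dvd_trans prime_elem_not_unit)
    qed
    ultimately have "u dvd 1"
      using prime_elem_imp_irreducible[OF \<pi>] by (auto simp: Factorial_Ring.irreducible_def)
    then have "\<pi> dvd Xpoly - Const \<alpha>" by (simp add: u mult_unit_dvd_iff)
    then show ?thesis using dvd[OF \<open>\<rho> dvd f H\<close>] by (rule dvd_trans)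
  qed
  have "\<exists>\<alpha>. \<rho> dvd f (Xpoly - Const \<alpha>)" if "\<rho> dvd f [:r:]" "r \<noteq> 0" for r
  proof -
    have "f [:c:] * f [:d:] = f [:c * d:]" for c d
      using f_mult[of "[:c:]" "[:d:]"] by (simp add: mult.commute)
    moreover have "f [:[:c:]:] dvd 1" if "c \<noteq> 0" for c
      using that by (subst is_unit_f_iff) (simp add: is_unit_poly_iff dvd_field_iff)
    ultimately have "\<exists>\<alpha>. \<rho> dvd f [:[:- \<alpha>, 1:]:]"
      using prime_dvd_linear_factor[of "\<lambda>r. f [:r:]" \<rho> r] \<rho> that by simp
    then show ?thesis by (simp add: Xpoly_def Const_def)
  qed
  with common_x have elim: ?thesis if "\<rho> dvd f [:r:]" "r \<noteq> 0" for r
    using that by blast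
  show ?thesis
  proof (rule ccontr)
    assume "\<not> \<pi> dvd H"
    then obtain a b r where "r \<noteq> 0" "a * \<pi> + b * H = [:r:]"
      using bezout_prime_elem[OF \<pi>] by blast
    moreover have "\<rho> dvd f (a * \<pi> + b * H)"
      using \<open>\<rho> dvd f \<pi>\<close> \<open>\<rho> dvd f H\<close> by (simp add: f_simps)
    ultimately have "\<pi> dvd H" using elim[of r] by simp
    with \<open>\<not> \<pi> dvd H\<close> show False ..
  qed
qed

text \<open>
  If \<open>\<rho>\<^sup>2\<close> divides \<open>f \<pi>\<close> then \<open>\<rho>\<close> divides the gradient of \<open>f \<pi>\<close>, hence, the Jacobian matrix being
  invertible, the images of both partial derivatives of \<open>\<pi>\<close>. By \<open>prime_lying_over_unique\<close> the prime \<open>\<pi>\<close>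
  divides its own partial derivatives.
\<close>

lemma prime_lying_over_unramified:
  assumes \<pi>: "prime_elem \<pi>" and \<rho>: "prime_elem \<rho>" and "\<rho> dvd f \<pi>"
  shows "\<not> \<rho> * \<rho> dvd f \<pi>"
proof
  assume "\<rho> * \<rho> dvd f \<pi>"
  then obtain u where u: "f \<pi> = \<rho> * \<rho> * u" by (rule dvdE)
  have "\<rho> dvd f (pderiv_x \<pi>)"
    using dvd_Jac_square_left[of \<rho> u "f Ypoly"] is_unit_jac
    unfolding u[symmetric] Jac_f_Ypoly[of \<pi>] by (simp add: dvd_mult_unit_iff)
  moreover have "\<rho> dvd f (pderiv_y \<pi>)"
    using dvd_Jac_square_right[of \<rho> "f Xpoly" u] is_unit_jac
    unfolding u[symmetric] Jac_f_Xpoly[of \<pi>] by (simp add: dvd_mult_unit_iff)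
  ultimately show False
    using prime_lying_over_unique[OF \<pi> \<rho> \<open>\<rho> dvd f \<pi>\<close>] prime_not_dvd_both_derivatives[OF \<pi>] by blast
qed

lemma multiplicity_f:
  assumes \<pi>: "prime_elem \<pi>" and \<rho>: "prime_elem \<rho>" and "\<rho> dvd f \<pi>" and "G \<noteq> 0"
  shows "multiplicity \<rho> (f G) = multiplicity \<pi> G"
proof -
  obtain H where H: "G = \<pi> ^ multiplicity \<pi> G * H" "\<not> \<pi> dvd H"
    using multiplicity_decompose'[of G \<pi>] \<pi> \<open>G \<noteq> 0\<close> by (auto simp: prime_elem_def)
  have "multiplicity \<rho> (f H) = 0"
    using prime_lying_over_unique[OF \<pi> \<rho> \<open>\<rho> dvd f \<pi>\<close>] H(2) by (auto intro: not_dvd_imp_multiplicity_0)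
  moreover have "multiplicity \<rho> (f \<pi>) = 1"
    using prime_lying_over_unramified[OF \<pi> \<rho> \<open>\<rho> dvd f \<pi>\<close>] \<open>\<rho> dvd f \<pi>\<close>
    by (intro multiplicity_eqI) (auto simp: power2_eq_square)
  moreover have "f \<pi> \<noteq> 0" "f H \<noteq> 0"
    using H \<pi> \<open>G \<noteq> 0\<close> by (auto simp: f_eq_0_iff)
  ultimately have "multiplicity \<rho> (f (\<pi> ^ multiplicity \<pi> G * H)) = multiplicity \<pi> G"
    using \<rho> by (simp add: f_simps prime_elem_multiplicity_mult_distrib prime_elem_multiplicity_power_distrib)
  with H(1) show ?thesis by simp
qed

text \<open>
  Every multiplicity of a prime in \<open>G\<close> is one in \<open>f G = w\<^sup>n\<close>, hence divisible by \<open>n\<close>. So \<open>G\<close> is an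
  \<open>n\<close>-th power up to a unit, and \<open>w\<close> differs from an element of the image by a constant factor.
\<close>

lemma range_f_closed_under_roots:
  assumes "n > 0" and w: "w ^ n = f G"
  shows "w \<in> range f"
proof (cases "G = 0")
  case True
  with assms have "w = f 0" by (simp add: f_0)
  then show ?thesis by simp
next
  case False
  have "n dvd multiplicity \<pi> G" if "Factorial_Ring.prime \<pi>" for \<pi>
  proof -
    from that have \<pi>: "prime_elem \<pi>" by simp
    then obtain \<rho> where \<rho>: "prime_elem \<rho>" "\<rho> dvd f \<pi>" by (rule prime_factor_of_f)
    have "w \<noteq> 0" using w False f_eq_0_iff[of G] \<open>n > 0\<close> by (auto simp: zero_power)
    then have "multiplicity \<pi> G = n * multiplicity \<rho> w"
      using multiplicity_f[OF \<pi> \<rho> False] \<rho>(1) by (simp add: w[symmetric] prime_elem_multiplicity_power_distrib)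
    then show ?thesis by simp
  qed
  then obtain H where H: "normalize G = H ^ n"
    using is_nth_power_conv_multiplicity[OF \<open>n > 0\<close>, of G] by (auto elim: is_nth_powerE)
  have "G dvd H ^ n" "H ^ n dvd G"
    by (simp_all flip: H)
  then have "w ^ n dvd f H ^ n" "f H ^ n dvd w ^ n"
    using f_dvd unfolding w by (auto simp flip: f_power)
  then have "w dvd f H" "f H dvd w"
    using \<open>n > 0\<close> by simp_all
  then have "normalize w = normalize (f H)" by (rule normalization_semidom_class.associatedI)
  then obtain u where u: "u dvd 1" "w = u * f H" by (rule normalization_semidom_class.associatedE1)
  then obtain c where "u = Const c" using is_unit_iff_Const by blast
  with u have "w = f (Const c * H)" by (simp add: f_simps)
  then show ?thesis by blast
qed

text \<open>
  This says \<open>B \<inter> K = A\<close>. In lowest terms, a prime factor of the denominator would have above it a prime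
  that divides the image of the numerator, and so would divide the numerator as well.
\<close>

lemma range_f_closed_under_quotients:
  assumes "w * f H = f G" "H \<noteq> 0"
  shows "w \<in> range f"
proof -
  define d where "d = gcd G H"
  have "d \<noteq> 0" using assms by (simp add: d_def)
  obtain G' H' where G': "G = G' * d" and H': "H = H' * d" and "coprime G' H'"
    using gcd_coprime_exists[of G H] \<open>d \<noteq> 0\<close> unfolding d_def by blast
  have w: "w * f H' = f G'"
    using assms(1) \<open>d \<noteq> 0\<close> by (simp add: G' H' f_mult f_eq_0_iff)
  have "H' \<noteq> 0" using assms H' by auto
  have "H' dvd 1"
  proof (rule ccontr)
    assume "\<not> H' dvd 1"
    then obtain \<pi> where "\<pi> dvd H'" "Factorial_Ring.prime \<pi>"
      using \<open>H' \<noteq> 0\<close> prime_divisor_exists by blast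
    then have \<pi>: "prime_elem \<pi>" by simp
    then obtain \<rho> where \<rho>: "prime_elem \<rho>" "\<rho> dvd f \<pi>" by (rule prime_factor_of_f)
    have "\<rho> dvd f G'"
      using dvd_trans[OF \<rho>(2) f_dvd[OF \<open>\<pi> dvd H'\<close>]] unfolding w[symmetric] by simp
    then have "\<pi> dvd G'" using prime_lying_over_unique \<pi> \<rho> by blast
    with \<open>\<pi> dvd H'\<close> \<open>coprime G' H'\<close> \<pi> show False
      by (meson coprime_common_divisor prime_elem_not_unit)
  qed
  then obtain c where c: "c \<noteq> 0" "H' = Const c" using is_unit_iff_Const by blast
  then have "Const c * Const (inverse c) = 1" by (simp flip: Const_simps(2,5))
  then have "w = w * f H' * Const (inverse c)" by (simp add: c f_Const mult.assoc)
  also have "\<dots> = f (G' * Const (inverse c))" by (simp add: w f_mult f_Const)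
  finally show ?thesis by blast
qed

section \<open>The field of fractions of the image\<close>

definition image_field :: "crat2 set" where
  "image_field = {to_fract (f G) / to_fract (f H) | G H. H \<noteq> 0}"

lemma image_fieldI: "H \<noteq> 0 \<Longrightarrow> u = to_fract (f G) / to_fract (f H) \<Longrightarrow> u \<in> image_field"
  unfolding image_field_def by blast

lemma image_fieldE:
  assumes "u \<in> image_field"
  obtains G H where "H \<noteq> 0" "to_fract (f H) \<noteq> 0" "u = to_fract (f G) / to_fract (f H)"
  using assms unfolding image_field_def by (auto simp: f_eq_0_iff)

lemma to_fract_in_image_field: "to_fract (f G) \<in> image_field"
  by (rule image_fieldI[of 1 _ G]) (simp_all add: f_1)

lemma image_field_add_mult:
  assumes "u \<in> image_field" "v \<in> image_field"
  shows "u + v \<in> image_field" "u * v \<in> image_field"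
proof -
  obtain G H where u: "H \<noteq> 0" "to_fract (f H) \<noteq> 0" "u = to_fract (f G) / to_fract (f H)"
    using assms(1) by (rule image_fieldE)
  obtain G' H' where v: "H' \<noteq> 0" "to_fract (f H') \<noteq> 0" "v = to_fract (f G') / to_fract (f H')"
    using assms(2) by (rule image_fieldE)
  show "u + v \<in> image_field"
    by (rule image_fieldI[of "H * H'" _ "G * H' + G' * H"]) (use u v in \<open>simp_all add: f_simps add_frac_eq\<close>)
  show "u * v \<in> image_field"
    by (rule image_fieldI[of "H * H'" _ "G * G'"]) (use u v in \<open>simp_all add: f_simps\<close>)
qed

lemma image_field_uminus_inverse:
  assumes "u \<in> image_field"
  shows "- u \<in> image_field" "inverse u \<in> image_field"
proof -
  obtain G H where u: "H \<noteq> 0" "to_fract (f H) \<noteq> 0" "u = to_fract (f G) / to_fract (f H)"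
    using assms by (rule image_fieldE)
  show "- u \<in> image_field"
    by (rule image_fieldI[of H _ "- G"]) (use u in \<open>simp_all add: f_simps\<close>)
  show "inverse u \<in> image_field"
  proof (cases "G = 0")
    case True
    with u to_fract_in_image_field[of 0] show ?thesis by (simp add: f_0)
  next
    case False
    then show ?thesis by (rule image_fieldI[of G _ H]) (use u in simp)
  qed
qed

lemmas image_field_closed = image_field_add_mult image_field_uminus_inverse

text \<open>
  The fractions of elements of the image are closed under the field operations and contain the
  generators.
\<close>

lemma gen_subfield_subset: "gen_subfield (f Xpoly) (f Ypoly) \<subseteq> image_field"
proof
  let ?R = "ring_of_type_algebra :: crat2 ring"
  interpret R: Ring.field ?R by (rule field_from_type_algebra)
  have minus: "\<ominus>\<^bsub>?R\<^esub> u = - u" for u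
    by (rule R.minus_equality) (simp_all add: ring_of_type_algebra_def)
  have inv: "inv\<^bsub>?R\<^esub> u = inverse u" if "u \<noteq> 0" for u
    by (rule R.comm_inv_char) (use that in \<open>simp_all add: ring_of_type_algebra_def\<close>)
  fix u assume "u \<in> gen_subfield (f Xpoly) (f Ypoly)"
  then show "u \<in> image_field"
    unfolding gen_subfield_def
  proof (induction u)
    case one
    then show ?case using to_fract_in_image_field[of 1] by (simp add: f_1 ring_of_type_algebra_def)
  next
    case (incl h)
    have "to_fract (Const c) \<in> image_field" for c
      using to_fract_in_image_field[of "Const c"] by (simp add: f_Const)
    with incl to_fract_in_image_field show ?case by auto
  next
    case (a_inv h)
    then show ?case using image_field_closed by (simp add: minus)
  next
    case (m_inv h)
    then have "h \<noteq> 0" by (simp add: ring_of_type_algebra_def)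
    with m_inv image_field_closed show ?case by (simp add: inv)
  next
    case (eng_add h1 h2)
    then show ?case using image_field_closed by (simp add: ring_of_type_algebra_def)
  next
    case (eng_mult h1 h2)
    then show ?case using image_field_closed by (simp add: ring_of_type_algebra_def)
  qed
qed

text \<open>
  Multiplying \<open>u\<close> by its denominator makes \<open>u\<^sup>n\<close> an element of \<open>A\<close>. The polynomial ring is integrally
  closed, so the root is a polynomial, and \<open>range_f_closed_under_roots\<close> applies to it.
\<close>

lemma image_field_closed_under_roots:
  assumes "n > 0" "u ^ n \<in> image_field"
  shows "u \<in> image_field"
proof -
  obtain G H where H: "H \<noteq> 0" "to_fract (f H) \<noteq> 0" "u ^ n = to_fract (f G) / to_fract (f H)"
    using assms(2) by (rule image_fieldE)
  obtain w z where "z \<noteq> 0" and wz: "u * to_fract (f H) = to_fract w / to_fract z"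
    by (metis Fract_cases Fract_conv_to_fract)
  have "(to_fract w / to_fract z) ^ n = u ^ n * to_fract (f H) ^ n"
    by (simp only: wz[symmetric] power_mult_distrib)
  also have "\<dots> = to_fract (f G) * to_fract (f H) ^ (n - 1)"
    using H(2) \<open>n > 0\<close> unfolding H(3) by (cases n) simp_all
  also have "\<dots> = to_fract (f (G * H ^ (n - 1)))"
    by (simp add: f_simps to_fract_power)
  finally have "to_fract (w ^ n) = to_fract (z ^ n * f (G * H ^ (n - 1)))"
    using \<open>z \<noteq> 0\<close> by (simp add: to_fract_power power_divide field_simps)
  then have *: "w ^ n = z ^ n * f (G * H ^ (n - 1))" by (simp only: to_fract_eq_iff)
  then have "z ^ n dvd w ^ n" by simp
  then have "z dvd w" using \<open>n > 0\<close> by simp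
  then obtain v where v: "w = z * v" by (rule dvdE)
  with * \<open>z \<noteq> 0\<close> have "v ^ n = f (G * H ^ (n - 1))" by (simp add: power_mult_distrib)
  with \<open>n > 0\<close> have "v \<in> range f" by (rule range_f_closed_under_roots)
  then obtain V where "v = f V" by blast
  with v wz \<open>z \<noteq> 0\<close> H show ?thesis by (intro image_fieldI[of H _ V]) (simp_all add: field_simps)
qed

section \<open>Recovering the coordinates\<close>

text \<open>
  If \<open>x = f g\<close> then \<open>\<partial>(f h)/\<partial>y = Jac (f g) (f h)\<close> is again in the image, by the chain rule. An element of
  the image with nonzero \<open>\<partial>/\<partial>y\<close> and least degree in \<open>y\<close> is therefore linear in \<open>y\<close>, and solving for
  \<open>y\<close> exhibits it as a quotient of elements of the image.
\<close>

lemma Ypoly_in_range: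
  assumes "Xpoly \<in> range f"
  shows "Ypoly \<in> range f"
proof -
  obtain g where g: "Xpoly = f g" using assms by blast
  obtain c where c: "Jac (f Xpoly) (f Ypoly) = f (Const c)" using jac f_Const by metis
  have stable: "pderiv u \<in> range f" if u: "u \<in> range f" for u
  proof -
    obtain h where "u = f h" using u by blast
    then have "pderiv u = Jac (f g) (f h)"
      by (simp add: Jac_def pderiv_x_simps pderiv_y_simps pderiv_y_def[symmetric] flip: g)
    also have "\<dots> = f (Jac g h * Const c)" by (simp add: Jac_f[of g h] c f_mult)
    finally show ?thesis by simp
  qed
  have const_range: "[:a:] \<in> range f" for a
  proof (induction a rule: const_poly_induct)
    case (Const c)
    then show ?case using f_Const by (metis rangeI)
  qed (use assms in \<open>auto simp flip: f_add f_mult\<close>)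
  have "pderiv (f Xpoly) \<noteq> 0 \<or> pderiv (f Ypoly) \<noteq> 0"
    using is_unit_jac by (auto simp: Jac_def pderiv_y_def)
  then obtain v where "v \<in> range f \<and> pderiv v \<noteq> 0" by blast
  then obtain u where u: "u \<in> range f" "pderiv u \<noteq> 0"
    and min: "\<And>v. v \<in> range f \<Longrightarrow> pderiv v \<noteq> 0 \<Longrightarrow> Polynomial.degree u \<le> Polynomial.degree v"
    using ex_has_least_nat[of "\<lambda>u. u \<in> range f \<and> pderiv u \<noteq> 0" v Polynomial.degree] by blast
  have "Polynomial.degree u \<noteq> 0" using u by (simp add: pderiv_eq_0_iff)
  then have "pderiv (pderiv u) = 0"
    using min[OF stable[OF u(1)]] by (fastforce simp: degree_pderiv)
  then have "Polynomial.degree u - 1 = 0" by (simp add: pderiv_eq_0_iff degree_pderiv)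
  moreover obtain a v where av: "u = pCons a v" by (rule pCons_cases)
  ultimately have "Polynomial.degree v = 0" by (cases "v = 0") simp_all
  then obtain b where "v = [:b:]" by (rule degree_eq_zeroE)
  with av have ab: "u = [:a, b:]" by simp
  with u have "b \<noteq> 0" by (auto simp: pderiv_pCons)
  obtain h A B where h: "u = f h" "[:a:] = f A" "[:b:] = f B" using u const_range by (metis rangeE)
  have "Ypoly * f B = f (h - A)"
    by (simp add: f_diff Ypoly_def ab flip: h)
  moreover have "B \<noteq> 0" using h \<open>b \<noteq> 0\<close> f_0 by auto
  ultimately show ?thesis by (rule range_f_closed_under_quotients)
qed

lemma automorphism_if_Xpoly_in_range:
  assumes "Xpoly \<in> range f"
  shows "alg_automorphism f"
proof -
  have "u \<in> range f" for u
  proof (induction u rule: cpoly2_induct)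
    case (Const c)
    then show ?case using f_Const by (metis rangeI)
  qed (use assms Ypoly_in_range in \<open>auto simp flip: f_add f_mult\<close>)
  then have "surj f" by blast
  moreover have "inj f" by (rule injI) (simp add: f_eq_iff)
  ultimately show ?thesis using endo by (simp add: alg_automorphism_def bij_def)
qed

lemma Xpoly_in_range:
  assumes "to_fract Xpoly \<in> image_field"
  shows "Xpoly \<in> range f"
proof -
  obtain G H where H: "H \<noteq> 0" "to_fract (f H) \<noteq> 0" "to_fract Xpoly = to_fract (f G) / to_fract (f H)"
    using assms by (rule image_fieldE)
  then have "to_fract (Xpoly * f H) = to_fract (f G)" by (simp add: field_simps)
  then have "Xpoly * f H = f G" by (simp only: to_fract_eq_iff)
  then show ?thesis using H(1) by (rule range_f_closed_under_quotients)
qed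

end

theorem theorem3p1:
  fixes f :: "cpoly2 \<Rightarrow> cpoly2" and p q :: cpoly2
  assumes "alg_endomorphism f"
    and "p = f Xpoly" and "q = f Ypoly"
    and "\<exists>c. c \<noteq> 0 \<and> Jac p q = Const c"
    and "\<exists>n::nat. n \<ge> 1 \<and> (\<exists>a \<in> gen_subfield p q - {0}. \<exists>b \<in> gen_subfield p q.
           (a * to_fract Xpoly + b) ^ n \<in> gen_subfield p q)"
  shows "alg_automorphism f"
proof -
  interpret keller_map f
    using assms(1-4) by unfold_locales simp_all
  have "gen_subfield p q \<subseteq> image_field"
    using gen_subfield_subset assms(2,3) by simp
  moreover obtain n :: nat and a b where "n \<ge> 1" and "a \<in> gen_subfield p q - {0}"
    and "b \<in> gen_subfield p q" and "(a * to_fract Xpoly + b) ^ n \<in> gen_subfield p q"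
    using assms(5) by blast
  ultimately have "n > 0" "a \<noteq> 0" and a: "a \<in> image_field" and b: "b \<in> image_field"
    and "(a * to_fract Xpoly + b) ^ n \<in> image_field"
    by auto
  then have "a * to_fract Xpoly + b \<in> image_field"
    using image_field_closed_under_roots by blast
  then have "(a * to_fract Xpoly + b) + - b \<in> image_field"
    using image_field_uminus_inverse(1)[OF b] by (rule image_field_add_mult(1))
  with image_field_uminus_inverse(2)[OF a]
  have "inverse a * ((a * to_fract Xpoly + b) + - b) \<in> image_field"
    by (rule image_field_add_mult(2))
  moreover have "inverse a * ((a * to_fract Xpoly + b) + - b) = to_fract Xpoly"
    using \<open>a \<noteq> 0\<close> by simp
  ultimately have "to_fract Xpoly \<in> image_field" by (simp only:)
  then show ?thesis
    by (intro automorphism_if_Xpoly_in_range Xpoly_in_range)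
qed

end
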